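(* Let $T$ be a non-trivial tree. Then $T\in\mathcal{F}$ if and only if $T$ is a $\gamma_{ri2}$-ER-critical tree.
   Context: All graphs are finite, without loops or multiple edges. A graph is trivial if it has a single vertex. A 2-rainbow independent dominating function (2RiDF) of a graph $G$ is a function $f:V(G)\to\{0,1,2\}$ such that, writing $V_i=\{x\in V(G): f(x)=i\}$, the sets $V_1$ and $V_2$ are each independent and every vertex $u$ with $f(u)=0$ is adjacent to at least one vertex of $V_1$ and at least one vertex of $V_2$. Its weight is $w(f)=|V_1|+|V_2|$. The 2-rainbow independent domination number $\gamma_{ri2}(G)$ is the minimum weight of a 2RiDF of $G$. A tree $T$ is $\gamma_{ri2}$-ER-critical if $\gamma_{ri2}(T-e)=\gamma_{ri2}(T)+1$ for each edge $e$ of $T$. The subdivision graph $S(G)$ is the graph obtained from $G$ by subdividing each edge of $G$ exactly once (replacing each edge $uv$ by a path $uwv$ with $w$ a new vertex). $\mathcal{F}=\{S(T'): T' \text{ is a non-trivial tree}\}$ (membership is understood up to isomorphism). *)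

theory Defs
  imports "Graph_Theory.Graph_Theory"
begin

text \<open>
  A finite simple graph is a \<^locale>\<open>pair_graph\<close>: a finite loop-free symmetric digraph without
  parallel arcs, in which the two arcs (u, v) and (v, u) together represent the edge uv.
\<close>

text \<open>
  The library predicates \<^const>\<open>forest\<close> and \<^const>\<open>tree\<close> are not usable here: the two arcs of a
  single edge form a \<^const>\<open>pre_digraph.cycle\<close> of length 2. The cycles of the undirected graph
  are the directed ones of length at least 3.
\<close>

definition graph_cycle :: "'a pair_pre_digraph \<Rightarrow> ('a \<times> 'a) list \<Rightarrow> bool" where
  "graph_cycle G p \<longleftrightarrow> pre_digraph.cycle (with_proj G) p \<and> 3 \<le> length p"

definition graph_tree :: "'a pair_pre_digraph \<Rightarrow> bool" where
  "graph_tree G \<longleftrightarrow> pair_graph G \<and> connected (with_proj G) \<and> (\<nexists>p. graph_cycle G p)"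

definition trivial_graph :: "'a pair_pre_digraph \<Rightarrow> bool" where
  "trivial_graph G \<longleftrightarrow> card (pverts G) = 1"

definition delete_edge :: "'a pair_pre_digraph \<Rightarrow> 'a \<Rightarrow> 'a \<Rightarrow> 'a pair_pre_digraph" where
  "delete_edge G u v = \<lparr> pverts = pverts G, parcs = parcs G - {(u, v), (v, u)} \<rparr>"

definition color_class :: "'a pair_pre_digraph \<Rightarrow> ('a \<Rightarrow> nat) \<Rightarrow> nat \<Rightarrow> 'a set" where
  "color_class G f i = {x \<in> pverts G. f x = i}"

definition independent_set :: "'a pair_pre_digraph \<Rightarrow> 'a set \<Rightarrow> bool" where
  "independent_set G A \<longleftrightarrow> A \<subseteq> pverts G \<and> (\<forall>x\<in>A. \<forall>y\<in>A. (x, y) \<notin> parcs G)"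

definition is_2RiDF :: "'a pair_pre_digraph \<Rightarrow> ('a \<Rightarrow> nat) \<Rightarrow> bool" where
  "is_2RiDF G f \<longleftrightarrow>
     (\<forall>x\<in>pverts G. f x \<in> {0, 1, 2}) \<and>
     independent_set G (color_class G f 1) \<and>
     independent_set G (color_class G f 2) \<and>
     (\<forall>u\<in>color_class G f 0.
        (\<exists>x\<in>color_class G f 1. (u, x) \<in> parcs G) \<and>
        (\<exists>y\<in>color_class G f 2. (u, y) \<in> parcs G))"

definition weight_2RiDF :: "'a pair_pre_digraph \<Rightarrow> ('a \<Rightarrow> nat) \<Rightarrow> nat" where
  "weight_2RiDF G f = card (color_class G f 1) + card (color_class G f 2)"

text \<open>
  Every finite simple graph has a 2RiDF, so the minimum is attained: take for colour 1 a maximal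
  independent set and for colour 2 a maximal independent set among the remaining vertices.
\<close>

definition gamma_ri2 :: "'a pair_pre_digraph \<Rightarrow> nat" where
  "gamma_ri2 G = (LEAST k. \<exists>f. is_2RiDF G f \<and> weight_2RiDF G f = k)"

definition ER_critical_tree :: "'a pair_pre_digraph \<Rightarrow> bool" where
  "ER_critical_tree T \<longleftrightarrow>
     graph_tree T \<and>
     (\<forall>(u, v)\<in>parcs T. gamma_ri2 (delete_edge T u v) = gamma_ri2 T + 1)"

text \<open>
  The new vertex on the edge uv is \<^term>\<open>Inr {u, v}\<close>. In a symmetric digraph both (u, v) and
  (v, u) are arcs, so this vertex becomes adjacent to both \<^term>\<open>Inl u\<close> and \<^term>\<open>Inl v\<close>.
\<close>

definition subdivision_graph :: "'a pair_pre_digraph \<Rightarrow> ('a + 'a set) pair_pre_digraph" where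
  "subdivision_graph G =
     \<lparr> pverts = Inl ` pverts G \<union> {Inr {u, v} | u v. (u, v) \<in> parcs G},
       parcs = (\<Union>(u, v)\<in>parcs G. {(Inl u, Inr {u, v}), (Inr {u, v}, Inl u)}) \<rparr>"

text \<open>
  Membership is up to isomorphism. Taking T' over the vertex type of T is no restriction, since the
  vertices of T' embed into those of any graph isomorphic to its subdivision graph.
\<close>

definition subdivided_trees :: "'a pair_pre_digraph set" where
  "subdivided_trees =
     {T. \<exists>T' :: 'a pair_pre_digraph. graph_tree T' \<and> \<not> trivial_graph T' \<and>
           digraph_iso (with_proj (subdivision_graph T')) (with_proj T)}"

end

theory Submission
  imports Defs
begin

text \<open>
  Call a colouring with values 0, 1, 2 exact if every edge has exactly one end of colour 0 and every
  vertex of colour 0 has exactly one neighbour of colour 1 and exactly one of colour 2. A tree has an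
  exact colouring iff it is a subdivided tree: the colours 1 and 2 form a proper 2-colouring of the
  original tree and colour 0 marks the subdivision vertices. In any graph, a 2RiDF \<open>f\<close> has weight
  \<open>n - |V\<^sub>0|\<close>, and \<open>4 |V\<^sub>0|\<close> is at most the number of arcs, with equality for exact \<open>f\<close>. Hence an exact
  colouring is a minimum 2RiDF, and removing an edge forces \<open>|V\<^sub>0|\<close> to drop; recolouring the end of
  colour 0 of the removed edge shows that it drops by exactly one. Conversely, let \<open>f\<close> be a minimum
  2RiDF of a critical tree. No edge can be removed without destroying \<open>f\<close>, so every edge joins a
  vertex of colour 0 to its only neighbour of some colour, which means that \<open>f\<close> is exact.
\<close>

section \<open>Acyclicity through bridges, and 2-colourings of forests\<close>

text \<open>
  Acyclicity in a form that passes to subrelations and transfers easily between a graph and its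
  subdivision; \<open>u = v\<close> is excluded by reflexivity of the closure.
\<close>

definition all_bridges :: "'a rel \<Rightarrow> bool" where
  "all_bridges R \<longleftrightarrow> (\<forall>u v. (u, v) \<in> R \<longrightarrow> (u, v) \<notin> (R - {(u, v), (v, u)})\<^sup>*)"

lemma all_bridges_subset: "all_bridges R \<Longrightarrow> S \<subseteq> R \<Longrightarrow> all_bridges S"
  unfolding all_bridges_def by (meson Diff_mono order_refl rtrancl_mono subsetD)

text \<open>Forests are bipartite; this supplies the colours 1 and 2 on the tree that is subdivided.
  The induction removes one edge, and since that edge is a bridge, a colouring of the rest can be
  repaired if it gives both ends the same colour.\<close>

lemma all_bridges_two_colouring:
  assumes "finite R" "sym R" "all_bridges R"
  shows "\<exists>c :: 'a \<Rightarrow> bool. \<forall>(x, y)\<in>R. c x \<noteq> c y"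
  using assms
proof (induction R rule: finite_psubset_induct)
  case (psubset R)
  show ?case
  proof (cases "R = {}")
    case False
    then obtain u v where uv: "(u, v) \<in> R" by auto
    define S where "S = R - {(u, v), (v, u)}"
    have "sym S" using \<open>sym R\<close> unfolding S_def sym_def by blast
    moreover have "S \<subset> R" using uv by (auto simp: S_def)
    moreover have "all_bridges S" using psubset.prems(2) \<open>S \<subset> R\<close> all_bridges_subset by blast
    ultimately obtain c :: "'a \<Rightarrow> bool" where c: "\<forall>(x, y)\<in>S. c x \<noteq> c y"
      using psubset.IH[of S] by auto
    have nr: "(u, v) \<notin> S\<^sup>*" using psubset.prems(2) uv by (simp add: all_bridges_def S_def)
    show ?thesis
    proof (cases "c u = c v")
      case True
      \<comment> \<open>\<open>u\<close> and \<open>v\<close> lie in different components of \<open>S\<close>, so swap the colours in that of \<open>u\<close>.\<close>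
      define d where "d x = (if (u, x) \<in> S\<^sup>* then \<not> c x else c x)" for x
      have "d x \<noteq> d y" if "(x, y) \<in> S" for x y
      proof -
        have "(u, x) \<in> S\<^sup>* \<longleftrightarrow> (u, y) \<in> S\<^sup>*"
          using that symD[OF \<open>sym S\<close>] by (meson rtrancl.rtrancl_into_rtrancl)
        then show ?thesis using c that by (auto simp: d_def)
      qed
      moreover have "d u \<noteq> d v" using nr True by (simp add: d_def)
      ultimately show ?thesis by (intro exI[of _ d]) (auto simp: S_def)
    next
      case False
      with c show ?thesis by (intro exI[of _ c]) (auto simp: S_def)
    qed
  qed auto
qed

section \<open>Connectedness and cycles expressed by the arc relation\<close>

lemma (in pair_wf_digraph) reachable_iff_rtrancl:
  "u \<in> pverts G \<Longrightarrow> u \<rightarrow>\<^sup>*\<^bsub>with_proj G\<^esub> v \<longleftrightarrow> (u, v) \<in> (parcs G)\<^sup>*"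
proof
  assume u: "u \<in> pverts G" and "(u, v) \<in> (parcs G)\<^sup>*"
  from this(2) show "u \<rightarrow>\<^sup>*\<^bsub>with_proj G\<^esub> v"
    by induction (use u in \<open>auto intro: adj_reachable_trans reachable_adj_trans\<close>)
next
  assume "u \<rightarrow>\<^sup>*\<^bsub>with_proj G\<^esub> v"
  then show "(u, v) \<in> (parcs G)\<^sup>*"
    by (auto simp: reachable_conv intro: rtrancl_mono[THEN subsetD, rotated])
qed

lemma (in pair_graph) connected_iff_rtrancl:
  "connected (with_proj G) \<longleftrightarrow> pverts G \<noteq> {} \<and> (\<forall>u\<in>pverts G. \<forall>v\<in>pverts G. (u, v) \<in> (parcs G)\<^sup>*)"
proof -
  \<comment> \<open>Symmetrising changes nothing, so connectedness is strong connectedness of the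
    graph itself.\<close>
  have "mk_symmetric (with_proj G) = G"
    unfolding mk_symmetric_def
    by (intro pair_pre_digraph.equality) (auto intro: arcs_symmetric)
  then show ?thesis
    by (simp add: connected_def strongly_connected_def reachable_iff_rtrancl)
qed

lemma (in pair_wf_digraph) pair_wf_delete_edge: "pair_wf_digraph (delete_edge G u v)"
  by unfold_locales (auto simp: delete_edge_def arc_fst_in_verts arc_snd_in_verts)

lemma parcs_delete_edge[simp]: "parcs (delete_edge G u v) = parcs G - {(u, v), (v, u)}"
  and pverts_delete_edge[simp]: "pverts (delete_edge G u v) = pverts G"
  by (auto simp: delete_edge_def)

text \<open>A path joining the ends of an edge without using that edge closes up to a cycle.
  Conversely, the other arcs of a cycle join the ends of its first arc.\<close>

lemma (in pair_graph) acyclic_iff_all_bridges: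
  "(\<nexists>p. graph_cycle G p) \<longleftrightarrow> all_bridges (parcs G)"
proof
  assume nc: "\<nexists>p. graph_cycle G p"
  show "all_bridges (parcs G)"
    unfolding all_bridges_def
  proof (intro allI impI notI)
    fix u v assume uv: "(u, v) \<in> parcs G" and r: "(u, v) \<in> (parcs G - {(u, v), (v, u)})\<^sup>*"
    interpret D: pair_wf_digraph "delete_edge G u v" by (rule pair_wf_delete_edge)
    have "u \<in> pverts G" "u \<noteq> v" using uv pair_no_loops[OF uv] by (auto dest: wellformed')
    then obtain p where p: "D.apath u p v"
      using r D.reachable_iff_rtrancl[of u v] by (auto simp: D.reachable_apath)
    then have ap: "set p \<subseteq> parcs G - {(u, v), (v, u)}" "pcas u p v" "distinct (pawalk_verts u p)"
      by (auto simp: D.apath_def D.awalk_def)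
    \<comment> \<open>A single step from \<open>u\<close> to \<open>v\<close> would be the deleted
      arc. This gives the closed walk the length 3 that \<open>graph_cycle\<close> demands.\<close>
    have "2 \<le> length p"
      using ap(1,2) \<open>u \<noteq> v\<close> by (cases p rule: list_exhaust_NSC) auto
    moreover have "awalk v ((v, u) # p) v"
      using ap uv by (auto simp: awalk_def arcs_symmetric dest: wellformed')
    ultimately have "graph_cycle G ((v, u) # p)"
      using ap(3) by (auto simp: graph_cycle_def cycle_def)
    with nc show False by blast
  qed
next
  assume br: "all_bridges (parcs G)"
  show "\<nexists>p. graph_cycle G p"
  proof
    assume "\<exists>p. graph_cycle G p"
    then obtain p u where p: "awalk u p u" "distinct (tl (pawalk_verts u p))" "3 \<le> length p"
      by (auto simp: graph_cycle_def cycle_def)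
    obtain e1 e2 e3 q where pe: "p = e1 # e2 # e3 # q"
      using p(3) by (auto simp: numeral_3_eq_3 Suc_le_length_iff)
    obtain v x where e: "e1 = (u, v)" "e2 = (v, x)"
      using p(1) pe by (cases e1; cases e2) (auto simp: awalk_simps)
    define r where "r = e3 # q"
    have w: "awalk x r u" "(u, v) \<in> parcs G" "(v, x) \<in> parcs G"
      and d: "v \<notin> set (pawalk_verts x r)" "distinct (pawalk_verts x r)"
      using p(1,2) unfolding pe e r_def by (auto simp: awalk_simps)
    \<comment> \<open>Otherwise the nonempty walk \<open>r\<close> is closed and meets
      \<open>u\<close> twice, against distinctness. Nonemptiness of \<open>r\<close> comes from the
      length being at least 3.\<close>
    have "x \<noteq> u"
    proof
      assume "x = u"
      have "u \<in> set (pawalk_verts (snd e3) q)"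
        using w(1) last_in_set[of "pawalk_verts (snd e3) q"]
        by (cases q) (auto simp: r_def awalk_simps)
      with d w(1) \<open>x = u\<close> show False by (auto simp: r_def awalk_simps)
    qed
    \<comment> \<open>The cycle passes through \<open>v\<close> only between its first two arcs, so
      no arc of \<open>r\<close> touches \<open>v\<close>.\<close>
    have sub: "set r \<subseteq> parcs G - {(u, v), (v, u)}"
    proof -
      have "(y, z) \<in> set r \<Longrightarrow> v \<noteq> y \<and> v \<noteq> z" for y z
        using d(1) awalk_verts_conv[of x r] w(1)
        by (metis awalk_verts_arc1 awalk_verts_arc2 fst_conv snd_conv)
      then show ?thesis using w(1) by auto
    qed
    have "(x, u) \<in> (parcs G - {(u, v), (v, u)})\<^sup>*"
      using w(1) sub
    proof (induction r arbitrary: x)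
      case (Cons a r)
      then show ?case by (cases a) (auto simp: awalk_simps intro: converse_rtrancl_into_rtrancl)
    qed (auto simp: awalk_simps)
    then have "(v, u) \<in> (parcs G - {(v, u), (u, v)})\<^sup>*"
      using w(3) \<open>x \<noteq> u\<close> w(2) pair_no_loops[OF w(2)]
      by (auto simp: insert_commute intro: converse_rtrancl_into_rtrancl)
    then show False using br w(2) by (auto simp: all_bridges_def dest: arcs_symmetric)
  qed
qed

section \<open>Isomorphisms of pair graphs as injective vertex maps\<close>

lemma digraph_iso_with_projI:
  assumes "pair_wf_digraph G" "inj_on h (pverts G)" "pverts H = h ` pverts G"
    and "parcs H = (\<lambda>(x, y). (h x, h y)) ` parcs G"
  shows "digraph_iso (with_proj G) (with_proj H)"
proof -
  interpret pair_wf_digraph G by fact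
  let ?f = "\<lparr> iso_verts = h, iso_arcs = (\<lambda>(x, y). (h x, h y)), iso_head = snd, iso_tail = fst \<rparr>"
  have "inj_on (\<lambda>(x, y). (h x, h y)) (parcs G)"
    using assms(2) by (auto simp: inj_on_def dest: wellformed')
  then have "pre_digraph.digraph_isomorphism (with_proj G) ?f"
    using assms(2) wf_digraph by (auto simp: pre_digraph.digraph_isomorphism_def)
  moreover have "with_proj H = app_iso ?f (with_proj G)"
    using assms(3,4) by (auto intro!: pre_digraph.equality)
  ultimately show ?thesis unfolding digraph_iso_def by blast
qed

text \<open>Both graphs use \<open>fst\<close> and \<open>snd\<close> as tail and head, so the arc
  component of an isomorphism is forced by its vertex component.\<close>

lemma digraph_iso_with_projE:
  assumes "digraph_iso (with_proj G) (with_proj H)"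
  obtains h where "inj_on h (pverts G)" "pverts H = h ` pverts G"
    and "parcs H = (\<lambda>(x, y). (h x, h y)) ` parcs G"
proof -
  obtain f where f: "pre_digraph.digraph_isomorphism (with_proj G) f"
    and H: "with_proj H = app_iso f (with_proj G)"
    using assms by (auto simp: digraph_iso_def)
  have t: "iso_tail f = fst" "iso_head f = snd" "pverts H = iso_verts f ` pverts G"
    "parcs H = iso_arcs f ` parcs G"
    using arg_cong[OF H, of tail] arg_cong[OF H, of head] arg_cong[OF H, of verts]
      arg_cong[OF H, of arcs] by simp_all
  have "iso_arcs f a = (\<lambda>(x, y). (iso_verts f x, iso_verts f y)) a" if "a \<in> parcs G" for a
    using f t that by (cases a) (force simp: pre_digraph.digraph_isomorphism_def prod_eq_iff)
  then have "parcs H = (\<lambda>(x, y). (iso_verts f x, iso_verts f y)) ` parcs G"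
    using t(4) by (auto simp: image_iff)
  then show ?thesis using that f t by (auto simp: pre_digraph.digraph_isomorphism_def)
qed

section \<open>Existence of 2RiDFs and the bound on the number of vertices of colour 0\<close>

lemma color_class_delete_edge[simp]: "color_class (delete_edge G u v) f i = color_class G f i"
  by (simp add: color_class_def)

lemma weight_2RiDF_delete_edge[simp]: "weight_2RiDF (delete_edge G u v) f = weight_2RiDF G f"
  by (simp add: weight_2RiDF_def)

lemma delete_edge_commute: "delete_edge G u v = delete_edge G v u"
  by (simp add: delete_edge_def insert_commute)

lemma (in pair_graph) pair_graph_delete_edge: "pair_graph (delete_edge G u v)"
proof -
  interpret D: pair_wf_digraph "delete_edge G u v" by (rule pair_wf_delete_edge)
  have "sym (parcs G - {(u, v), (v, u)})" by (auto simp: sym_def arcs_symmetric)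
  then show ?thesis
    using pair_finite_verts pair_finite_arcs pair_no_loops
    by unfold_locales (auto simp: symmetric_def)
qed

lemma gamma_ri2_le: "is_2RiDF G f \<Longrightarrow> gamma_ri2 G \<le> weight_2RiDF G f"
  unfolding gamma_ri2_def by (rule Least_le) blast

lemma is_2RiDF_neighbour:
  assumes "is_2RiDF G f" "u \<in> pverts G" "f u = 0" "i \<in> {1, 2}"
  shows "\<exists>x\<in>pverts G. (u, x) \<in> parcs G \<and> f x = i"
  using assms unfolding is_2RiDF_def color_class_def by auto

lemma (in pair_graph) ex_2RiDF: "\<exists>f. is_2RiDF G f"
proof -
  \<comment> \<open>A colouring of maximum weight among those with independent classes is a 2RiDF.\<close>
  define P where "P f \<longleftrightarrow> (\<forall>x\<in>pverts G. f x \<in> {0, 1, 2}) \<and> independent_set G (color_class G f 1)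
    \<and> independent_set G (color_class G f 2)" for f
  have "P (\<lambda>_. 0)" by (auto simp: P_def independent_set_def color_class_def)
  moreover have "weight_2RiDF G f < 2 * card (pverts G) + 1" for f
  proof -
    have "card (color_class G f i) \<le> card (pverts G)" for i
      using pair_finite_verts by (intro card_mono) (auto simp: color_class_def)
    from this[of 1] this[of 2] show ?thesis by (simp add: weight_2RiDF_def)
  qed
  ultimately have "\<exists>f. P f \<and> (\<forall>g. P g \<longrightarrow> weight_2RiDF G g \<le> weight_2RiDF G f)"
    by (intro ex_has_greatest_nat) auto
  then obtain f where "P f" and mx: "\<And>g. P g \<Longrightarrow> weight_2RiDF G g \<le> weight_2RiDF G f"
    by blast
  then have f: "\<forall>x\<in>pverts G. f x \<in> {0, 1, 2}" "independent_set G (color_class G f 1)"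
    "independent_set G (color_class G f 2)" unfolding P_def by blast+
  have "\<exists>x\<in>color_class G f i. (u, x) \<in> parcs G"
    if u: "u \<in> pverts G" "f u = 0" and i: "i \<in> {1, 2}" for u i
  proof (rule ccontr)
    assume no: "\<not> ?thesis"
    \<comment> \<open>Without a neighbour of colour \<open>i\<close>, the vertex \<open>u\<close>
      can itself take colour \<open>i\<close>, which raises the weight by one.\<close>
    let ?g = "f(u := i)"
    have ci: "color_class G ?g i = insert u (color_class G f i)" "u \<notin> color_class G f i"
      using u i by (auto simp: color_class_def)
    have cj: "color_class G ?g j = color_class G f j" if "j \<noteq> 0" "j \<noteq> i" for j
      using u that by (auto simp: color_class_def)
    have "independent_set G (color_class G ?g i)"
      unfolding ci using f i u no by (auto simp: independent_set_def dest: arcs_symmetric pair_no_loops)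
    then have "P ?g" using f i cj[of 1] cj[of 2] unfolding P_def by (cases "i = 1") auto
    moreover have "finite (color_class G f i)"
      using pair_finite_verts by (auto simp: color_class_def)
    then have "weight_2RiDF G ?g = weight_2RiDF G f + 1"
      using i ci cj[of 1] cj[of 2] by (auto simp: weight_2RiDF_def)
    ultimately show False using mx[of ?g] by simp
  qed
  then have "is_2RiDF G f" using f by (auto simp: is_2RiDF_def color_class_def)
  then show ?thesis by blast
qed

lemma (in pair_graph) gamma_ri2_attained:
  obtains f where "is_2RiDF G f" "weight_2RiDF G f = gamma_ri2 G"
proof -
  have "\<exists>f. is_2RiDF G f \<and> weight_2RiDF G f = gamma_ri2 G"
    unfolding gamma_ri2_def by (rule LeastI_ex) (use ex_2RiDF in blast)
  then show thesis using that by blast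
qed

text \<open>The colour classes partition the vertices. Lower bounds on the weight thus become upper
  bounds on the number of vertices of colour 0.\<close>

lemma (in pair_graph) weight_plus_zero_class:
  assumes "is_2RiDF G f"
  shows "weight_2RiDF G f + card (color_class G f 0) = card (pverts G)"
proof -
  have "pverts G = color_class G f 1 \<union> color_class G f 2 \<union> color_class G f 0"
    using assms by (auto simp: is_2RiDF_def color_class_def)
  moreover have "finite (color_class G f i)" for i
    using pair_finite_verts by (auto simp: color_class_def)
  moreover have "color_class G f i \<inter> color_class G f j = {}" if "i \<noteq> j" for i j
    using that by (auto simp: color_class_def)
  ultimately show ?thesis
    by (simp add: weight_2RiDF_def card_Un_disjoint Int_Un_distrib2)
qed

text \<open>Each vertex of colour 0 owns two edges, one to a chosen neighbour of each nonzero
  colour, hence four arcs. Such an edge has only one end of colour 0, so nothing is counted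
  twice.\<close>

lemma (in pair_graph) four_zero_class_le:
  assumes f: "is_2RiDF G f"
  shows "4 * card (color_class G f 0) \<le> card (parcs G)"
proof -
  define n where "n i u = (SOME x. (u, x) \<in> parcs G \<and> f x = (if i then 1 else 2))" for i u
  have n: "(u, n i u) \<in> parcs G \<and> f (n i u) = (if i then 1 else 2)"
    if "u \<in> pverts G" "f u = 0" for i u
    unfolding n_def by (rule someI_ex) (use is_2RiDF_neighbour[OF f that, of "if i then 1 else 2"] in \<open>auto split: if_splits\<close>)
  let ?V = "color_class G f 0"
  \<comment> \<open>\<open>i\<close> selects the colour of the neighbour and \<open>j\<close> the direction of the arc.\<close>
  let ?h = "\<lambda>(u, i, j). if j then (u, n i u) else (n i u, u)"
  have "inj_on ?h (?V \<times> (UNIV :: (bool \<times> bool) set))"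
  proof (rule inj_onI)
    fix p p' assume p: "p \<in> ?V \<times> UNIV" "p' \<in> ?V \<times> UNIV" "?h p = ?h p'"
    obtain u i j u' i' j' where pp: "p = (u, i, j)" "p' = (u', i', j')" by (metis prod_cases3)
    have u: "u \<in> ?V" "u' \<in> ?V"
      and eq: "(if j then (u, n i u) else (n i u, u)) = (if j' then (u', n i' u') else (n i' u', u'))"
      using p pp by auto
    have a: "f u = 0" "f (n i u) = (if i then 1 else 2)" "f u' = 0" "f (n i' u') = (if i' then 1 else 2)"
      using u n by (auto simp: color_class_def)
    \<comment> \<open>Chosen neighbours have nonzero colour, so equal arcs must run in the same
      direction.\<close>
    then have ne: "u \<noteq> n i' u'" "u' \<noteq> n i u" by (metis zero_neq_one zero_neq_numeral)+
    have j: "j = j'" using eq ne by (cases j; cases j'; simp)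
    then have nn: "u = u'" "n i u = n i' u'" using eq by (cases j'; simp)+
    then have "i = i'" using a(2,4) by (cases i; cases i'; simp)
    with j nn pp show "p = p'" by simp
  qed
  moreover have "?h ` (?V \<times> UNIV) \<subseteq> parcs G"
    using n arcs_symmetric by (auto simp: color_class_def split: if_splits)
  ultimately have "card (?V \<times> (UNIV :: (bool \<times> bool) set)) \<le> card (parcs G)"
    using pair_finite_arcs by (rule card_inj_on_le)
  then show ?thesis by (simp add: card_cartesian_product card_UNIV_bool flip: UNIV_Times_UNIV)
qed

section \<open>Exact colourings are minimum 2RiDFs and force criticality\<close>

definition exact_2RiDF :: "'a pair_pre_digraph \<Rightarrow> ('a \<Rightarrow> nat) \<Rightarrow> bool" where
  "exact_2RiDF G f \<longleftrightarrow>
     (\<forall>x\<in>pverts G. f x \<in> {0, 1, 2}) \<and>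
     (\<forall>u v. (u, v) \<in> parcs G \<longrightarrow> (f u = 0) \<noteq> (f v = 0)) \<and>
     (\<forall>w\<in>pverts G. f w = 0 \<longrightarrow> (\<exists>a b. f a = 1 \<and> f b = 2 \<and> parcs G `` {w} = {a, b}))"

lemma exact_2RiDF_range: "exact_2RiDF G f \<Longrightarrow> x \<in> pverts G \<Longrightarrow> f x \<in> {0, 1, 2}"
  unfolding exact_2RiDF_def by (elim conjE bspec)

lemma exact_2RiDF_alternates: "exact_2RiDF G f \<Longrightarrow> (u, v) \<in> parcs G \<Longrightarrow> (f u = 0) \<noteq> (f v = 0)"
  unfolding exact_2RiDF_def by (elim conjE, drule spec[of _ u], drule spec[of _ v], drule (1) mp)

lemma exact_2RiDF_neighbours:
  assumes "exact_2RiDF G f" "w \<in> pverts G" "f w = 0"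
  obtains a b where "f a = 1" "f b = 2" "parcs G `` {w} = {a, b}"
proof -
  have "\<exists>a b. f a = 1 \<and> f b = 2 \<and> parcs G `` {w} = {a, b}"
    using assms unfolding exact_2RiDF_def by (elim conjE) simp
  then show thesis using that by blast
qed

context pair_graph
begin

text \<open>Independence of the classes comes from alternation: each edge has an end of colour 0, so
  none lies inside class 1 or class 2.\<close>

lemma exact_2RiDF_is_2RiDF:
  assumes "exact_2RiDF G f"
  shows "is_2RiDF G f"
proof -
  have "(\<exists>x\<in>color_class G f 1. (u, x) \<in> parcs G) \<and> (\<exists>y\<in>color_class G f 2. (u, y) \<in> parcs G)"
    if u: "u \<in> color_class G f 0" for u
  proof -
    obtain a b where ab: "f a = 1" "f b = 2" "parcs G `` {u} = {a, b}"
      using exact_2RiDF_neighbours[OF assms, of u] u by (auto simp: color_class_def)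
    then have "(u, a) \<in> parcs G" "(u, b) \<in> parcs G" by auto
    then show ?thesis using ab by (auto simp: color_class_def dest: wellformed')
  qed
  moreover have "independent_set G (color_class G f i)" if "i \<noteq> 0" for i
    unfolding independent_set_def color_class_def
  proof (intro conjI ballI notI)
    fix x y assume "x \<in> {x \<in> pverts G. f x = i}" "y \<in> {x \<in> pverts G. f x = i}" "(x, y) \<in> parcs G"
    with exact_2RiDF_alternates[OF assms, of x y] that show False by auto
  qed auto
  ultimately show ?thesis
    using exact_2RiDF_range[OF assms] by (auto simp: is_2RiDF_def)
qed

text \<open>The map from \<open>four_zero_class_le\<close> is now onto: every arc has an end of
  colour 0, and the two chosen neighbours of that end are all its neighbours.\<close>

lemma exact_2RiDF_card_parcs:
  assumes f: "exact_2RiDF G f"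
  shows "card (parcs G) \<le> 4 * card (color_class G f 0)"
proof -
  define n where "n i u = (SOME x. (u, x) \<in> parcs G \<and> f x = (if i then 1 else 2))" for i u
  let ?V = "color_class G f 0"
  let ?h = "\<lambda>(u, i, j). if j then (u, n i u) else (n i u, u)"
  \<comment> \<open>Of the two neighbours of \<open>u\<close> only \<open>x\<close> has the colour
    of \<open>x\<close>, so the choice must return it.\<close>
  have n: "x = n (f x = 1) u" if ux: "(u, x) \<in> parcs G" "f u = 0" for u x
  proof -
    obtain a b where ab: "f a = 1" "f b = 2" "parcs G `` {u} = {a, b}"
      using exact_2RiDF_neighbours[OF f in_arcsD1[OF ux(1)] ux(2)] .
    then have x: "x = a \<or> x = b" using that by auto
    have "(u, n (f x = 1) u) \<in> parcs G \<and> f (n (f x = 1) u) = (if f x = 1 then 1 else 2)"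
      unfolding n_def by (rule someI[of _ x]) (use x ab that in auto)
    then have "n (f x = 1) u \<in> {a, b} \<and> f (n (f x = 1) u) = (if f x = 1 then 1 else 2)"
      using ab(3) by auto
    then show ?thesis using x ab by (auto split: if_splits)
  qed
  have "parcs G \<subseteq> ?h ` (?V \<times> UNIV)"
  proof clarify
    fix u v assume uv: "(u, v) \<in> parcs G"
    then consider "f u = 0" | "f v = 0" using exact_2RiDF_alternates[OF f uv] by auto
    then show "(u, v) \<in> ?h ` (?V \<times> UNIV)"
    proof cases
      case 1
      then have "?h (u, f v = 1, True) = (u, v)" using n[OF uv] by simp
      with 1 uv show ?thesis by (intro image_eqI[of _ _ "(u, f v = 1, True)"]) (auto simp: color_class_def dest: wellformed')
    next
      case 2
      then have "?h (v, f u = 1, False) = (u, v)" using n[of v u] uv by (simp add: arcs_symmetric)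
      with 2 uv show ?thesis by (intro image_eqI[of _ _ "(v, f u = 1, False)"]) (auto simp: color_class_def dest: wellformed')
    qed
  qed
  moreover have "finite ?V" using pair_finite_verts by (simp add: color_class_def)
  ultimately have "card (parcs G) \<le> card (?V \<times> (UNIV :: (bool \<times> bool) set))"
    by (intro surj_card_le) auto
  then show ?thesis by (simp add: card_cartesian_product card_UNIV_bool flip: UNIV_Times_UNIV)
qed

text \<open>For every 2RiDF \<open>g\<close>, four times its number of zeros is at most the number
  of arcs, hence at most four times that of \<open>f\<close>. So \<open>f\<close> has the most zeros
  and the least weight.\<close>

lemma exact_2RiDF_weight:
  assumes "exact_2RiDF G f"
  shows "weight_2RiDF G f = gamma_ri2 G"
proof -
  note f = exact_2RiDF_is_2RiDF[OF assms]
  obtain g where g: "is_2RiDF G g" "weight_2RiDF G g = gamma_ri2 G" by (rule gamma_ri2_attained)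
  have "4 * card (color_class G g 0) \<le> 4 * card (color_class G f 0)"
    using four_zero_class_le[OF g(1)] exact_2RiDF_card_parcs[OF assms] by linarith
  then show ?thesis
    using weight_plus_zero_class[OF f] weight_plus_zero_class[OF g(1)] gamma_ri2_le[OF f] g(2)
    by linarith
qed

text \<open>Recolouring \<open>u\<close> gives the upper bound. The lower bound is the counting
  bound applied to the graph with fewer arcs.\<close>

lemma exact_2RiDF_critical_arc:
  assumes ex: "exact_2RiDF G f" and uv: "(u, v) \<in> parcs G" and u: "f u = 0"
  shows "gamma_ri2 (delete_edge G u v) = gamma_ri2 G + 1"
proof (rule antisym)
  interpret D: pair_graph "delete_edge G u v" by (rule pair_graph_delete_edge)
  note f = exact_2RiDF_is_2RiDF[OF ex]
  have V: "u \<in> pverts G" "v \<in> pverts G" "u \<noteq> v" "(v, u) \<in> parcs G"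
    using uv pair_no_loops[OF uv] by (auto dest: wellformed' arcs_symmetric)
  have fv: "f v \<in> {1, 2}" using exact_2RiDF_alternates[OF ex uv] u exact_2RiDF_range[OF ex V(2)] by auto
  \<comment> \<open>Once the edge to \<open>v\<close> is gone, \<open>x\<close> is the only
    neighbour of \<open>u\<close>. Its colour differs from that of \<open>v\<close>, so
    \<open>u\<close> may take the colour of \<open>v\<close>.\<close>
  obtain x where x: "parcs G `` {u} = {v, x}" "f x \<noteq> f v"
  proof -
    obtain a b where ab: "f a = 1" "f b = 2" "parcs G `` {u} = {a, b}"
      using exact_2RiDF_neighbours[OF ex V(1) u] .
    then have "v = a \<or> v = b" using uv by auto
    then show thesis using that[of a] that[of b] ab by (auto simp: insert_commute)
  qed
  let ?g = "f(u := f v)"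
  have cl: "color_class G ?g i = (if i = f v then insert u (color_class G f i) else color_class G f i)"
    if "i \<noteq> 0" for i
    using that u V fv by (auto simp: color_class_def)
  have nb: "z = v \<or> z = x" "z \<noteq> u" if "(u, z) \<in> parcs G" for z
    using x that no_loops'[OF that] by auto
  have g: "is_2RiDF (delete_edge G u v) ?g"
    unfolding is_2RiDF_def
  proof (intro conjI ballI)
    fix y assume "y \<in> pverts (delete_edge G u v)"
    then show "?g y \<in> {0, 1, 2}" using f fv by (auto simp: is_2RiDF_def)
  next
    have "independent_set (delete_edge G u v) (color_class G ?g i)" if "i \<in> {1, 2}" for i
    proof -
      have ind: "independent_set G (color_class G f i)" using f that by (auto simp: is_2RiDF_def)
      have nu: "(u, y) \<notin> parcs G - {(u, v), (v, u)}" "(y, u) \<notin> parcs G - {(u, v), (v, u)}"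
        if "f y = f v \<or> y = u" for y
        using nb[of y] x(2) that by (auto dest: arcs_symmetric)
      show ?thesis
        unfolding independent_set_def
      proof (intro conjI ballI)
        fix y z assume yz: "y \<in> color_class G ?g i" "z \<in> color_class G ?g i"
        show "(y, z) \<notin> parcs (delete_edge G u v)"
        proof (cases "y = u \<or> z = u")
          case True
          then have "f v = i" using yz by (auto simp: color_class_def)
          then show ?thesis
            using True yz nu[of y] nu[of z] by (auto simp: color_class_def split: if_splits)
        next
          case False
          then show ?thesis using ind yz by (auto simp: color_class_def independent_set_def)
        qed
      qed (auto simp: color_class_def)
    qed
    then show "independent_set (delete_edge G u v) (color_class (delete_edge G u v) ?g 1)"
      "independent_set (delete_edge G u v) (color_class (delete_edge G u v) ?g 2)" by auto
  next
    fix w assume "w \<in> color_class (delete_edge G u v) ?g 0"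
    then have w: "w \<in> pverts G" "f w = 0" "w \<noteq> u" "w \<noteq> v" using fv by (auto simp: color_class_def split: if_splits)
    have "\<exists>y\<in>color_class G ?g i. (w, y) \<in> parcs (delete_edge G u v)" if "i \<in> {1, 2}" for i
    proof -
      obtain y where "y \<in> pverts G" "(w, y) \<in> parcs G" "f y = i" using is_2RiDF_neighbour[OF f w(1,2) \<open>i \<in> {1, 2}\<close>] by blast
      \<comment> \<open>The old neighbour \<open>y\<close> still serves \<open>w\<close>: it is not
        \<open>u\<close>, which had colour 0, and the arc survives because \<open>w\<close> is
        neither \<open>u\<close> nor \<open>v\<close>.\<close>
      then show ?thesis using w that u by (intro bexI[of _ y]) (auto simp: color_class_def)
    qed
    then show "\<exists>x\<in>color_class (delete_edge G u v) ?g 1. (w, x) \<in> parcs (delete_edge G u v)"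
      "\<exists>y\<in>color_class (delete_edge G u v) ?g 2. (w, y) \<in> parcs (delete_edge G u v)" by auto
  qed
  have "finite (color_class G f (f v))" "u \<notin> color_class G f (f v)"
    using pair_finite_verts fv u by (auto simp: color_class_def)
  then have "weight_2RiDF G ?g = weight_2RiDF G f + 1"
    using fv by (auto simp: weight_2RiDF_def cl)
  then show "gamma_ri2 (delete_edge G u v) \<le> gamma_ri2 G + 1"
    using gamma_ri2_le[OF g] exact_2RiDF_weight[OF ex] by simp
  obtain h where h: "is_2RiDF (delete_edge G u v) h"
    "weight_2RiDF (delete_edge G u v) h = gamma_ri2 (delete_edge G u v)"
    by (rule D.gamma_ri2_attained)
  \<comment> \<open>Strictness matters: any 2RiDF \<open>h\<close> of the smaller graph has strictly
    fewer zeros than \<open>f\<close>, so its weight is larger by at least one.\<close>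
  have "card (parcs G - {(u, v), (v, u)}) < card (parcs G)"
    using uv pair_finite_arcs by (intro psubset_card_mono) auto
  then have "card (color_class G h 0) < card (color_class G f 0)"
    using D.four_zero_class_le[OF h(1)] exact_2RiDF_card_parcs[OF ex] by simp
  then show "gamma_ri2 G + 1 \<le> gamma_ri2 (delete_edge G u v)"
    using D.weight_plus_zero_class[OF h(1)] weight_plus_zero_class[OF f] h(2) exact_2RiDF_weight[OF ex]
    by simp
qed

lemma exact_2RiDF_critical:
  assumes ex: "exact_2RiDF G f" and uv: "(u, v) \<in> parcs G"
  shows "gamma_ri2 (delete_edge G u v) = gamma_ri2 G + 1"
proof (cases "f u = 0")
  case False
  then have "f v = 0" using exact_2RiDF_alternates[OF ex uv] by auto
  then show ?thesis
    using exact_2RiDF_critical_arc[OF ex arcs_symmetric[OF uv]] by (simp add: delete_edge_commute)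
qed (use exact_2RiDF_critical_arc[OF ex uv] in simp)

section \<open>Minimum 2RiDFs of critical graphs are exact\<close>

text \<open>Deleting an edge keeps the colour range and independence, so \<open>f\<close> can fail
  only at a vertex \<open>p\<close> of colour 0 that loses its last neighbour \<open>q\<close> of
  some colour.\<close>

lemma essential_edge:
  assumes f: "is_2RiDF G f" and nf: "\<not> is_2RiDF (delete_edge G u v) f"
  obtains p q where "(p, q) = (u, v) \<or> (p, q) = (v, u)" "f p = 0" "f q \<in> {1, 2}"
    "\<And>y. (p, y) \<in> parcs G \<Longrightarrow> f y = f q \<Longrightarrow> y = q"
proof -
  have "independent_set (delete_edge G u v) (color_class (delete_edge G u v) f i)" if "i \<in> {1, 2}" for i
    using f that by (auto simp: is_2RiDF_def independent_set_def)
  moreover have "\<forall>x\<in>pverts (delete_edge G u v). f x \<in> {0, 1, 2}"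
    using f by (simp add: is_2RiDF_def)
  ultimately obtain p where p0: "p \<in> color_class G f 0"
    and "(\<nexists>x. x \<in> color_class G f 1 \<and> (p, x) \<in> parcs G - {(u, v), (v, u)}) \<or>
      (\<nexists>x. x \<in> color_class G f 2 \<and> (p, x) \<in> parcs G - {(u, v), (v, u)})"
    using nf unfolding is_2RiDF_def by (simp only: color_class_delete_edge parcs_delete_edge) blast
  then obtain i where i: "i \<in> {1, 2}"
    and no: "\<nexists>x. x \<in> color_class G f i \<and> (p, x) \<in> parcs G - {(u, v), (v, u)}" by blast
  have p: "p \<in> pverts G" "f p = 0" "i \<in> {1, 2}" using p0 i by (simp_all add: color_class_def)
  obtain q where q: "(p, q) \<in> parcs G" "f q = i" using is_2RiDF_neighbour[OF f p] by blast
  \<comment> \<open>All neighbours of \<open>p\<close> of colour \<open>i\<close> lie across the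
    deleted edge, so there is just one.\<close>
  have pq: "y = q \<and> ((p, y) = (u, v) \<or> (p, y) = (v, u))" if "(p, y) \<in> parcs G" "f y = i" for y
  proof -
    have d: "(p, z) = (u, v) \<or> (p, z) = (v, u)" if "(p, z) \<in> parcs G" "f z = i" for z
      using no that in_arcsD2[OF that(1)] by (auto simp: color_class_def)
    show ?thesis using d[OF that] d[OF q] by auto
  qed
  show thesis
  proof (rule that[of p q])
    show "(p, q) = (u, v) \<or> (p, q) = (v, u)" using pq[OF q] by blast
    show "f p = 0" "f q \<in> {1, 2}" using p q by simp_all
    show "y = q" if "(p, y) \<in> parcs G" "f y = f q" for y
      using pq[OF that(1)] that(2) q(2) by blast
  qed
qed

text \<open>If a minimum \<open>f\<close> survived a deletion, its weight would bound the domination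
  number of the smaller graph. So \<open>essential_edge\<close> applies to every edge: it yields
  alternation and, at each vertex of colour 0, at most one neighbour per colour.\<close>

lemma critical_imp_exact_2RiDF:
  assumes "\<And>u v. (u, v) \<in> parcs G \<Longrightarrow> gamma_ri2 G < gamma_ri2 (delete_edge G u v)"
  obtains f where "exact_2RiDF G f"
proof -
  obtain f where f: "is_2RiDF G f" "weight_2RiDF G f = gamma_ri2 G" by (rule gamma_ri2_attained)
  have nf: "\<not> is_2RiDF (delete_edge G u v) f" if "(u, v) \<in> parcs G" for u v
    using assms[OF that] gamma_ri2_le[of "delete_edge G u v" f] f(2) by auto
  have alt: "(f u = 0) \<noteq> (f v = 0)" if "(u, v) \<in> parcs G" for u v
  proof (rule essential_edge[OF f(1) nf[OF that]])
    fix p q assume "(p, q) = (u, v) \<or> (p, q) = (v, u)" "f p = 0" "f q \<in> {1, 2}"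
    then show ?thesis by auto
  qed
  have uniq: "y = x" if "(w, x) \<in> parcs G" "(w, y) \<in> parcs G" "f w = 0" "f y = f x" for w x y
  proof (rule essential_edge[OF f(1) nf[OF that(1)]])
    fix p q assume pq: "(p, q) = (w, x) \<or> (p, q) = (x, w)" "f q \<in> {1, 2}"
      and u: "\<And>y. (p, y) \<in> parcs G \<Longrightarrow> f y = f q \<Longrightarrow> y = q"
    from pq that(3) have "p = w" "q = x" by auto
    then show "y = x" using u that(2,4) by blast
  qed
  have "\<exists>a b. f a = 1 \<and> f b = 2 \<and> parcs G `` {w} = {a, b}" if w: "w \<in> pverts G" "f w = 0" for w
  proof -
    obtain a where a: "(w, a) \<in> parcs G" "f a = 1" using is_2RiDF_neighbour[OF f(1) w, of 1] by auto
    obtain b where b: "(w, b) \<in> parcs G" "f b = 2" using is_2RiDF_neighbour[OF f(1) w, of 2] by auto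
    have "y = a \<or> y = b" if "(w, y) \<in> parcs G" for y
    proof -
      have "f y = 1 \<or> f y = 2"
        using f(1) alt[OF that] w in_arcsD2[OF that] by (auto simp: is_2RiDF_def)
      then show ?thesis using uniq a b w that by metis
    qed
    then show ?thesis using a b by blast
  qed
  then have "exact_2RiDF G f"
    using f(1) alt unfolding exact_2RiDF_def is_2RiDF_def by (intro conjI) simp_all
  then show thesis by (rule that)
qed

end

section \<open>Subdivided trees have exact colourings\<close>

lemma subdivision_graph_simps:
  "pverts (subdivision_graph G) = Inl ` pverts G \<union> {Inr {u, v} | u v. (u, v) \<in> parcs G}"
  "parcs (subdivision_graph G) = (\<Union>(u, v)\<in>parcs G. {(Inl u, Inr {u, v}), (Inr {u, v}, Inl u)})"
  by (simp_all add: subdivision_graph_def)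

context pair_graph
begin

lemma pair_wf_subdivision_graph: "pair_wf_digraph (subdivision_graph G)"
  by unfold_locales (auto simp: subdivision_graph_simps dest: wellformed')

lemma subdivision_graph_exact:
  fixes c :: "'a \<Rightarrow> bool"
  assumes c: "\<And>u v. (u, v) \<in> parcs G \<Longrightarrow> c u \<noteq> c v"
  shows "exact_2RiDF (subdivision_graph G) (case_sum (\<lambda>x. if c x then 1 else 2) (\<lambda>_. 0))"
    (is "exact_2RiDF ?S ?f")
proof -
  have "\<exists>a b. ?f a = 1 \<and> ?f b = 2 \<and> parcs ?S `` {w} = {a, b}"
    if w: "w \<in> pverts ?S" "?f w = 0" for w
  proof -
    obtain u v where uv: "(u, v) \<in> parcs G" "w = Inr {u, v}"
      using w by (auto simp: subdivision_graph_simps split: if_splits)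
    \<comment> \<open>The arcs \<open>(u, v)\<close> and \<open>(v, u)\<close> share the subdivision
      vertex \<open>w\<close>, and each contributes its tail as a neighbour.\<close>
    have nb: "parcs ?S `` {w} = {Inl u, Inl v}"
      using uv arcs_symmetric[OF uv(1)] by (auto simp: subdivision_graph_simps doubleton_eq_iff)
    show ?thesis
    proof (cases "c u")
      case True
      then show ?thesis using c[OF uv(1)] nb by (intro exI[of _ "Inl u"] exI[of _ "Inl v"]) simp
    next
      case False
      then show ?thesis using c[OF uv(1)] nb
        by (intro exI[of _ "Inl v"] exI[of _ "Inl u"]) (simp add: insert_commute)
    qed
  qed
  then show ?thesis
    unfolding exact_2RiDF_def by (auto simp: subdivision_graph_simps split: sum.splits)
qed

end

lemma exact_2RiDF_transfer:
  assumes "pair_wf_digraph G" and g: "exact_2RiDF G g"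
    and h: "inj_on h (pverts G)" "pverts H = h ` pverts G" "parcs H = (\<lambda>(x, y). (h x, h y)) ` parcs G"
  shows "exact_2RiDF H (g \<circ> the_inv_into (pverts G) h)" (is "exact_2RiDF H ?f")
proof -
  interpret pair_wf_digraph G by fact
  have f: "?f (h x) = g x" if "x \<in> pverts G" for x
    using the_inv_into_f_f[OF h(1) that] by simp
  have "\<exists>a b. ?f a = 1 \<and> ?f b = 2 \<and> parcs H `` {w} = {a, b}"
    if w: "w \<in> pverts H" "?f w = 0" for w
  proof -
    obtain x where x: "x \<in> pverts G" "w = h x" using w h(2) by auto
    then have "g x = 0" using w f by simp
    then obtain a b where ab: "g a = 1" "g b = 2" "parcs G `` {x} = {a, b}"
      using exact_2RiDF_neighbours[OF g x(1)] by blast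
    then have V: "a \<in> pverts G" "b \<in> pverts G" using in_arcsD2[of x] by auto
    have "parcs H `` {w} = h ` (parcs G `` {x})"
      using x h(1) unfolding h(3) by (auto simp: inj_on_def image_iff dest: wellformed')
    then show ?thesis using ab V f by (intro exI[of _ "h a"] exI[of _ "h b"]) simp
  qed
  moreover have "(?f u = 0) \<noteq> (?f v = 0)" if "(u, v) \<in> parcs H" for u v
  proof -
    obtain x y where xy: "(x, y) \<in> parcs G" "u = h x" "v = h y" using \<open>(u, v) \<in> parcs H\<close> h(3) by auto
    show ?thesis
      unfolding xy(2,3) f[OF in_arcsD1[OF xy(1)]] f[OF in_arcsD2[OF xy(1)]]
      using exact_2RiDF_alternates[OF g xy(1)] .
  qed
  moreover have "?f x \<in> {0, 1, 2}" if x: "x \<in> pverts H" for x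
  proof -
    obtain y where y: "y \<in> pverts G" "x = h y" using x h(2) by auto
    show ?thesis unfolding y(2) f[OF y(1)] by (rule exact_2RiDF_range[OF g y(1)])
  qed
  ultimately show ?thesis unfolding exact_2RiDF_def by (intro conjI allI impI ballI)
qed

lemma subdivided_tree_exact:
  assumes "T \<in> subdivided_trees"
  shows "\<exists>f. exact_2RiDF T f"
proof -
  obtain T' :: "'a pair_pre_digraph" where T': "graph_tree T'"
    and iso: "digraph_iso (with_proj (subdivision_graph T')) (with_proj T)"
    using assms by (auto simp: subdivided_trees_def)
  interpret pair_graph T' using T' by (simp add: graph_tree_def)
  have "sym (parcs T')" by (auto intro: symI arcs_symmetric)
  moreover have "all_bridges (parcs T')" using T' acyclic_iff_all_bridges by (simp add: graph_tree_def)
  ultimately obtain c :: "'a \<Rightarrow> bool" where "\<forall>(x, y)\<in>parcs T'. c x \<noteq> c y"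
    using all_bridges_two_colouring[OF pair_finite_arcs] by blast
  then have "\<exists>g. exact_2RiDF (subdivision_graph T') g"
    using subdivision_graph_exact[of c] by blast
  then show ?thesis
    using exact_2RiDF_transfer[OF pair_wf_subdivision_graph] digraph_iso_with_projE[OF iso] by metis
qed

section \<open>Recovering the original tree from an exact colouring\<close>

locale exact_tree = pair_graph T for T :: "'a pair_pre_digraph" +
  fixes f :: "'a \<Rightarrow> nat"
  assumes tree: "graph_tree T" and nontrivial: "\<not> trivial_graph T" and exact: "exact_2RiDF T f"
begin

text \<open>The tree of which \<open>T\<close> is the subdivision: contract the paths through vertices of colour 0.\<close>

definition base :: "'a pair_pre_digraph" where
  "base = \<lparr> pverts = {x \<in> pverts T. f x \<noteq> 0},
     parcs = {(a, b). a \<noteq> b \<and> (\<exists>w. f w = 0 \<and> (w, a) \<in> parcs T \<and> (w, b) \<in> parcs T)} \<rparr>"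

lemma base_simps:
  "pverts base = {x \<in> pverts T. f x \<noteq> 0}"
  "parcs base = {(a, b). a \<noteq> b \<and> (\<exists>w. f w = 0 \<and> (w, a) \<in> parcs T \<and> (w, b) \<in> parcs T)}"
  by (simp_all add: base_def)

lemma zero_imp_nonzero: "(x, y) \<in> parcs T \<Longrightarrow> f x = 0 \<Longrightarrow> f y \<noteq> 0"
  and nonzero_imp_zero: "(x, y) \<in> parcs T \<Longrightarrow> f x \<noteq> 0 \<Longrightarrow> f y = 0"
  using exact_2RiDF_alternates[OF exact, of x y] by simp_all

lemma mid_neighbours:
  assumes "f w = 0" "(w, a) \<in> parcs T" "(w, b) \<in> parcs T" "a \<noteq> b"
  shows "parcs T `` {w} = {a, b}"
proof -
  obtain c d where "parcs T `` {w} = {c, d}"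
    using exact_2RiDF_neighbours[OF exact in_arcsD1[OF assms(2)] assms(1)] by blast
  moreover have "a \<in> parcs T `` {w}" "b \<in> parcs T `` {w}" using assms by auto
  ultimately show ?thesis using assms(4) by auto
qed

lemma zero_neighbours:
  assumes "w \<in> pverts T" "f w = 0"
  shows "\<exists>a b. a \<noteq> b \<and> (w, a) \<in> parcs T \<and> (w, b) \<in> parcs T \<and> parcs T `` {w} = {a, b}"
proof -
  obtain a b where ab: "f a = 1" "f b = 2" "parcs T `` {w} = {a, b}"
    using exact_2RiDF_neighbours[OF exact assms] .
  then have "(w, a) \<in> parcs T" "(w, b) \<in> parcs T" "a \<noteq> b" by auto
  then show ?thesis using ab(3) by blast
qed

lemma bridges: "all_bridges (parcs T)"
  using tree acyclic_iff_all_bridges by (simp add: graph_tree_def)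

lemma bridge:
  assumes "(u, v) \<in> parcs T" "(u, v) \<in> (parcs T - {(u, v), (v, u)})\<^sup>*"
  shows False
  using bridges assms unfolding all_bridges_def by blast

text \<open>Two middle vertices for the same pair would form a 4-cycle: \<open>w\<close> reaches
  \<open>a\<close> through \<open>b\<close> and \<open>w'\<close>, avoiding the edge between
  \<open>w\<close> and \<open>a\<close>.\<close>

lemma mid_unique:
  assumes "f w = 0" "f w' = 0" "a \<noteq> b" "(w, a) \<in> parcs T" "(w, b) \<in> parcs T"
    "(w', a) \<in> parcs T" "(w', b) \<in> parcs T"
  shows "w = w'"
proof (rule ccontr)
  assume "w \<noteq> w'"
  have "a \<noteq> w" "a \<noteq> w'" "b \<noteq> w" "b \<noteq> w'"
    using assms zero_imp_nonzero by metis+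
  then have "(w, b) \<in> parcs T - {(w, a), (a, w)}" "(b, w') \<in> parcs T - {(w, a), (a, w)}"
    "(w', a) \<in> parcs T - {(w, a), (a, w)}"
    using assms \<open>w \<noteq> w'\<close> by (auto intro: arcs_symmetric)
  then have "(w, a) \<in> (parcs T - {(w, a), (a, w)})\<^sup>*"
    by (meson converse_rtrancl_into_rtrancl rtrancl.rtrancl_refl)
  then show False using bridge assms(4) by blast
qed

lemma pair_graph_base: "pair_graph base"
proof -
  have "parcs base \<subseteq> pverts base \<times> pverts base"
    using zero_imp_nonzero by (auto simp: base_simps dest: wellformed')
  moreover have "finite (pverts base)" using pair_finite_verts by (simp add: base_simps)
  ultimately have "finite (parcs base)" by (meson finite_SigmaI finite_subset)
  moreover have "sym (parcs base)" by (auto simp: base_simps sym_def)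
  ultimately show ?thesis
    using \<open>parcs base \<subseteq> pverts base \<times> pverts base\<close> \<open>finite (pverts base)\<close>
    by unfold_locales (auto simp: symmetric_def base_simps)
qed

text \<open>A walk in \<open>T\<close> also visits vertices of colour 0, which are absent from
  \<open>base\<close>. For these the induction carries reachability of all their neighbours
  instead.\<close>

lemma base_reach:
  assumes "(a, x) \<in> (parcs T)\<^sup>*" "f a \<noteq> 0"
  shows "(f x \<noteq> 0 \<longrightarrow> (a, x) \<in> (parcs base)\<^sup>*) \<and>
    (f x = 0 \<longrightarrow> (\<forall>b. (x, b) \<in> parcs T \<longrightarrow> (a, b) \<in> (parcs base)\<^sup>*))"
  using assms(1)
proof (induction rule: rtrancl_induct)
  case base
  then show ?case using assms(2) by simp
next
  case (step x y)
  show ?case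
  proof (cases "f x = 0")
    case True
    then have "f y \<noteq> 0" using zero_imp_nonzero[OF step(2)] by simp
    then show ?thesis using step True by simp
  next
    case False
    then have y: "f y = 0" and ax: "(a, x) \<in> (parcs base)\<^sup>*"
      using nonzero_imp_zero[OF step(2)] step(3) by simp_all
    have "(a, b) \<in> (parcs base)\<^sup>*" if "(y, b) \<in> parcs T" for b
    proof (cases "b = x")
      case False
      then have "(x, b) \<in> parcs base"
        using y that arcs_symmetric[OF step(2)] by (auto simp: base_simps)
      then show ?thesis using ax by (rule rtrancl_into_rtrancl[rotated])
    qed (use ax in simp)
    then show ?thesis using y by simp
  qed
qed

lemma T_connected: "u \<in> pverts T \<Longrightarrow> v \<in> pverts T \<Longrightarrow> (u, v) \<in> (parcs T)\<^sup>*"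
  and T_nonempty: "pverts T \<noteq> {}"
  using tree connected_iff_rtrancl by (auto simp: graph_tree_def)

text \<open>A connected nontrivial graph has an edge, and one of its ends has colour 0.\<close>

lemma ex_zero: "\<exists>w\<in>pverts T. f w = 0"
proof -
  have "card (pverts T) \<noteq> 1" using nontrivial by (simp add: trivial_graph_def)
  then obtain x y where xy: "x \<in> pverts T" "y \<in> pverts T" "x \<noteq> y"
    using T_nonempty by (metis is_singletonI' is_singleton_altdef)
  then obtain z where "(x, z) \<in> parcs T" using T_connected[OF xy(1,2)] by (meson converse_rtranclE)
  then show ?thesis using nonzero_imp_zero[of x z] wellformed'[of x z]
    by (cases "f x = 0") blast+
qed

lemma base_not_trivial: "\<not> trivial_graph base"
proof -
  obtain w where w: "w \<in> pverts T" "f w = 0" using ex_zero by blast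
  then obtain a b where "a \<noteq> b" "(w, a) \<in> parcs T" "(w, b) \<in> parcs T" using zero_neighbours[of w] by blast
  then have "a \<in> pverts base" "b \<in> pverts base" "a \<noteq> b"
    using zero_imp_nonzero[of w] w wellformed'[of w] by (auto simp: base_simps)
  then show ?thesis unfolding trivial_graph_def by (metis card_1_singletonE singletonD)
qed

text \<open>A detour from \<open>a\<close> to \<open>b\<close> in \<open>base\<close> lifts to
  \<open>T\<close> by reinserting middle vertices. Followed by the step from \<open>b\<close> to
  \<open>w\<close>, it bypasses the edge between \<open>a\<close> and \<open>w\<close>, which is a
  bridge of \<open>T\<close>.\<close>

lemma all_bridges_base: "all_bridges (parcs base)"
  unfolding all_bridges_def
proof (intro allI impI notI)
  fix a b assume ab: "(a, b) \<in> parcs base" and r: "(a, b) \<in> (parcs base - {(a, b), (b, a)})\<^sup>*"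
  obtain w where w: "a \<noteq> b" "f w = 0" "(w, a) \<in> parcs T" "(w, b) \<in> parcs T"
    using ab by (auto simp: base_simps)
  let ?R = "parcs T - {(a, w), (w, a)}"
  have "(c, d) \<in> ?R\<^sup>*" if cd: "(c, d) \<in> parcs base - {(a, b), (b, a)}" for c d
  proof -
    obtain v where v: "c \<noteq> d" "f v = 0" "(v, c) \<in> parcs T" "(v, d) \<in> parcs T"
      using cd by (auto simp: base_simps)
    \<comment> \<open>The only neighbours of \<open>w\<close> are \<open>a\<close> and
      \<open>b\<close>, so it is the middle of no other edge of \<open>base\<close>.\<close>
    have "v \<noteq> w"
    proof
      assume "v = w"
      then have "{a, b} = {c, d}"
        using mid_neighbours[OF v(2,3,4,1)] mid_neighbours[OF w(2,3,4,1)] by simp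
      then show False using cd by (auto simp: doubleton_eq_iff)
    qed
    moreover have "c \<noteq> w" "d \<noteq> w"
      using zero_imp_nonzero[OF v(3)] zero_imp_nonzero[OF v(4)] v(2) w(2) by auto
    ultimately have "(c, v) \<in> ?R" "(v, d) \<in> ?R" using v by (auto intro: arcs_symmetric)
    then show ?thesis by (meson converse_rtrancl_into_rtrancl rtrancl.rtrancl_refl)
  qed
  then have "parcs base - {(a, b), (b, a)} \<subseteq> ?R\<^sup>*" by auto
  then have "(a, b) \<in> ?R\<^sup>*" using r rtrancl_subset_rtrancl by blast
  moreover have "b \<noteq> w" using zero_imp_nonzero[OF w(4)] w(2) by auto
  then have "(b, w) \<in> ?R" using w by (auto intro: arcs_symmetric)
  ultimately have "(a, w) \<in> ?R\<^sup>*" by (rule rtrancl_into_rtrancl)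
  then show False using bridge arcs_symmetric[OF w(3)] by blast
qed

lemma graph_tree_base: "graph_tree base"
proof -
  interpret B: pair_graph base by (rule pair_graph_base)
  have "pverts base \<noteq> {}"
  proof -
    obtain w where w: "w \<in> pverts T" "f w = 0" using ex_zero by blast
    then obtain a where "(w, a) \<in> parcs T" using zero_neighbours[of w] by blast
    then have "a \<in> pverts base"
      using zero_imp_nonzero[of w a] w wellformed'[of w a] by (auto simp: base_simps)
    then show ?thesis by blast
  qed
  moreover have "(u, v) \<in> (parcs base)\<^sup>*" if "u \<in> pverts base" "v \<in> pverts base" for u v
    using base_reach[OF T_connected, of u v] that by (simp add: base_simps)
  ultimately show ?thesis
    using pair_graph_base B.connected_iff_rtrancl B.acyclic_iff_all_bridges all_bridges_base
    by (simp add: graph_tree_def)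
qed

text \<open>The isomorphism from \<open>T\<close> onto the subdivision of \<open>base\<close>. The
  neighbourhood of a vertex of colour 0 is the two-element set that names its subdivision
  vertex.\<close>

definition label :: "'a \<Rightarrow> 'a + 'a set" where
  "label x = (if f x = 0 then Inr (parcs T `` {x}) else Inl x)"

text \<open>For vertices of colour 0 this rests on acyclicity: by \<open>mid_unique\<close>, equal
  neighbourhoods belong to the same vertex.\<close>

lemma inj_on_label: "inj_on label (pverts T)"
proof (rule inj_onI)
  fix x y assume xy: "x \<in> pverts T" "y \<in> pverts T" "label x = label y"
  show "x = y"
  proof (cases "f x = 0")
    case True
    then have y: "f y = 0" "parcs T `` {x} = parcs T `` {y}"
      using xy(3) by (auto simp: label_def split: if_splits)
    obtain a b where ab: "a \<noteq> b" "(x, a) \<in> parcs T" "(x, b) \<in> parcs T"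
      using zero_neighbours[OF xy(1) True] by blast
    then have "(y, a) \<in> parcs T" "(y, b) \<in> parcs T" using y(2) by auto
    then show ?thesis using mid_unique True y(1) ab by blast
  qed (use xy(3) in \<open>auto simp: label_def split: if_splits\<close>)
qed

lemma label_mid:
  assumes "f w = 0" "(w, a) \<in> parcs T" "(w, b) \<in> parcs T" "a \<noteq> b"
  shows "label w = Inr {a, b}"
  using assms mid_neighbours[OF assms] by (simp add: label_def)

lemma pverts_subdivision_base: "pverts (subdivision_graph base) = label ` pverts T"
proof
  show "pverts (subdivision_graph base) \<subseteq> label ` pverts T"
  proof
    fix s assume "s \<in> pverts (subdivision_graph base)"
    then consider x where "s = Inl x" "x \<in> pverts T" "f x \<noteq> 0"
      | a b where "s = Inr {a, b}" "(a, b) \<in> parcs base"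
      by (auto simp: subdivision_graph_simps base_simps(1))
    then show "s \<in> label ` pverts T"
    proof cases
      case 1
      then show ?thesis by (intro image_eqI[of _ _ x]) (auto simp: label_def)
    next
      case 2
      then obtain w where w: "a \<noteq> b" "f w = 0" "(w, a) \<in> parcs T" "(w, b) \<in> parcs T"
        by (auto simp: base_simps)
      then show ?thesis using 2(1) label_mid[OF w(2,3,4,1)] in_arcsD1[OF w(3)] by (metis imageI)
    qed
  qed
  show "label ` pverts T \<subseteq> pverts (subdivision_graph base)"
  proof
    fix s assume "s \<in> label ` pverts T"
    then obtain x where x: "x \<in> pverts T" "s = label x" by blast
    show "s \<in> pverts (subdivision_graph base)"
    proof (cases "f x = 0")
      case True
      then obtain a b where ab: "a \<noteq> b" "(x, a) \<in> parcs T" "(x, b) \<in> parcs T"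
        using zero_neighbours[OF x(1)] by blast
      then have "(a, b) \<in> parcs base" using True by (auto simp: base_simps)
      then show ?thesis using x label_mid[OF True ab(2,3,1)] by (auto simp: subdivision_graph_simps)
    next
      case False
      then show ?thesis using x by (simp add: label_def subdivision_graph_simps base_simps)
    qed
  qed
qed

lemma parcs_subdivision_base:
  "parcs (subdivision_graph base) = (\<lambda>(x, y). (label x, label y)) ` parcs T"
proof
  let ?h = "\<lambda>(x, y). (label x, label y)"
  show "parcs (subdivision_graph base) \<subseteq> ?h ` parcs T"
  proof
    fix e assume "e \<in> parcs (subdivision_graph base)"
    then obtain a b where ab: "(a, b) \<in> parcs base"
      and e: "e = (Inl a, Inr {a, b}) \<or> e = (Inr {a, b}, Inl a)"
      by (auto simp: subdivision_graph_simps)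
    obtain w where w: "a \<noteq> b" "f w = 0" "(w, a) \<in> parcs T" "(w, b) \<in> parcs T"
      using ab by (auto simp: base_simps)
    have "label a = Inl a" using zero_imp_nonzero[OF w(3,2)] by (simp add: label_def)
    then have "?h (w, a) = (Inr {a, b}, Inl a)" "?h (a, w) = (Inl a, Inr {a, b})"
      using label_mid[OF w(2,3,4,1)] by simp_all
    then have "e = ?h (w, a) \<or> e = ?h (a, w)" using e by auto
    then show "e \<in> ?h ` parcs T"
      using imageI[OF w(3), of ?h] imageI[OF arcs_symmetric[OF w(3)], of ?h] by (elim disjE) (simp_all only:)
  qed
  have zero: "(label x, label y) \<in> parcs (subdivision_graph base) \<and>
      (label y, label x) \<in> parcs (subdivision_graph base)"
    if xy: "(x, y) \<in> parcs T" "f x = 0" for x y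
  proof -
    obtain a b where ab: "a \<noteq> b" "(x, a) \<in> parcs T" "(x, b) \<in> parcs T"
      using zero_neighbours[OF in_arcsD1[OF xy(1)] xy(2)] by blast
    \<comment> \<open>With \<open>z\<close> the other neighbour of \<open>x\<close>, the vertex
      \<open>x\<close> subdivides the edge of \<open>base\<close> between \<open>y\<close> and
      \<open>z\<close>.\<close>
    then obtain z where z: "y \<noteq> z" "(x, z) \<in> parcs T" by metis
    have "(y, z) \<in> parcs base" using xy z by (auto simp: base_simps)
    moreover have "label y = Inl y" using zero_imp_nonzero[OF xy] by (simp add: label_def)
    ultimately show ?thesis
      using label_mid[OF xy(2,1) z(2,1)] by (auto simp: subdivision_graph_simps)
  qed
  show "?h ` parcs T \<subseteq> parcs (subdivision_graph base)"
  proof clarify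
    fix x y assume xy: "(x, y) \<in> parcs T"
    show "(label x, label y) \<in> parcs (subdivision_graph base)"
    proof (cases "f x = 0")
      case False
      then show ?thesis using zero[OF arcs_symmetric[OF xy]] nonzero_imp_zero[OF xy] by simp
    qed (use zero[OF xy] in blast)
  qed
qed

lemma subdivided: "T \<in> subdivided_trees"
proof -
  have "digraph_iso (with_proj T) (with_proj (subdivision_graph base))"
    by (rule digraph_iso_with_projI[OF pair_wf_digraph inj_on_label
          pverts_subdivision_base parcs_subdivision_base])
  then have "digraph_iso (with_proj (subdivision_graph base)) (with_proj T)"
    by (rule digraph_iso_swap[OF wf_digraph])
  then show ?thesis
    using graph_tree_base base_not_trivial unfolding subdivided_trees_def by blast
qed

end

theorem theorem26:
  fixes T :: "'a pair_pre_digraph"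
  assumes "graph_tree T" and "\<not> trivial_graph T"
  shows "T \<in> subdivided_trees \<longleftrightarrow> ER_critical_tree T"
proof -
  interpret pair_graph T using assms(1) by (simp add: graph_tree_def)
  show ?thesis
  proof
    assume "T \<in> subdivided_trees"
    then obtain f where "exact_2RiDF T f" using subdivided_tree_exact by blast
    then show "ER_critical_tree T"
      using assms(1) exact_2RiDF_critical by (auto simp: ER_critical_tree_def)
  next
    assume crit: "ER_critical_tree T"
    have "gamma_ri2 T < gamma_ri2 (delete_edge T u v)" if "(u, v) \<in> parcs T" for u v
      using crit that by (fastforce simp: ER_critical_tree_def)
    then obtain f where "exact_2RiDF T f" by (rule critical_imp_exact_2RiDF)
    then interpret exact_tree T f using assms by unfold_locales
    show "T \<in> subdivided_trees" by (rule subdivided)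
  qed
qed

end
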